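(* For all integers $i,k\ge0$ and $-1\le l\le 2i+1$ there is a vector potential $\phi^l_{i,k}$ with ${\rm B}^l_{i,k}={\bf curl}(\phi^l_{i,k})$, namely $$\phi^l_{i,k}:=-\mathfrak{b}^l_{i,k}\nabla\Delta=\frac{\Delta^k\,{\rm N}^{l+1}(z^{i+1})}{(i+1)\kappa_{l+1,2i+2}}\,(z,-2y,x).$$
   Context: Work over $\mathbb{R}$ with coordinates $(x,y,z)$ and $\Delta:=xz-y^2$. Vector fields are identified both with derivations and with triples of components; $[v,w]=vw-wv$ and ${\rm ad}_v w=[v,w]$. Let ${\rm N}=x\frac{\partial}{\partial y}+2y\frac{\partial}{\partial z}$, ${\rm M}=z\frac{\partial}{\partial y}+2y\frac{\partial}{\partial x}$, and $\kappa_{l,m}:=\frac{m!}{(m-l)!}$. For integers $i,k\ge 0$, $-1\le l\le 2i+1$, $${\rm B}^l_{i,k}:=\frac{{\rm ad}_{\rm N}^{\,l+1}(z^i\Delta^k{\rm M})}{\kappa_{l+1,2i+2}},\qquad \mathfrak{b}^l_{i,k}:=-\frac{{\rm N}^{l+1}(z^{i+1}\Delta^k)}{(i+1)\kappa_{l+1,2i+2}},$$ where ${\rm N}$ acts on scalar functions as a differential operator. *)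

theory Defs
  imports "HOL-Analysis.Analysis"
begin

type_synonym scalar_field = "real^3 \<Rightarrow> real"
type_synonym vector_field = "real^3 \<Rightarrow> real^3"

text \<open>The coordinates x, y, z of a point p are p $ 1, p $ 2, p $ 3. All fields below are
  polynomial, hence smooth, so partial derivatives may be read off the Frechet derivative.\<close>

definition coord :: "3 \<Rightarrow> scalar_field" where
  "coord j = (\<lambda>p. p $ j)"

definition pderivative :: "3 \<Rightarrow> scalar_field \<Rightarrow> scalar_field" where
  "pderivative j f = (\<lambda>p. frechet_derivative f (at p) (axis j 1))"

definition grad :: "scalar_field \<Rightarrow> vector_field" where
  "grad f = (\<lambda>p. \<chi> j. pderivative j f p)"

definition curl :: "vector_field \<Rightarrow> vector_field" where
  "curl F = (\<lambda>p. vector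
     [pderivative 2 (\<lambda>q. F q $ 3) p - pderivative 3 (\<lambda>q. F q $ 2) p,
      pderivative 3 (\<lambda>q. F q $ 1) p - pderivative 1 (\<lambda>q. F q $ 3) p,
      pderivative 1 (\<lambda>q. F q $ 2) p - pderivative 2 (\<lambda>q. F q $ 1) p])"

text \<open>Differentiability is required because the curl of a nondifferentiable field is a
  meaningless default value.\<close>

definition vector_potential :: "vector_field \<Rightarrow> vector_field \<Rightarrow> bool" where
  "vector_potential \<phi> v \<longleftrightarrow> \<phi> differentiable_on UNIV \<and> v = curl \<phi>"

definition derivation :: "vector_field \<Rightarrow> scalar_field \<Rightarrow> scalar_field" where
  "derivation v f = (\<lambda>p. \<Sum>j\<in>UNIV. v p $ j * pderivative j f p)"

lemma derivation_coord: "derivation v (coord j) = (\<lambda>p. v p $ j)"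
proof
  fix p :: "real^3"
  have "frechet_derivative (coord j) (at p) = (\<lambda>h. h $ j)"
    unfolding coord_def
    by (rule frechet_derivative_at[symmetric])
      (rule bounded_linear_imp_has_derivative[OF bounded_linear_vec_nth])
  then show "derivation v (coord j) p = v p $ j"
    by (simp add: derivation_def pderivative_def axis_def if_distrib cong: if_cong)
qed

text \<open>A derivation is identified with the triple of its values on the coordinate functions
  (see the lemma above); applied to the derivation vw - wv this gives the components of [v,w].\<close>

definition lie_bracket :: "vector_field \<Rightarrow> vector_field \<Rightarrow> vector_field" where
  "lie_bracket v w = (\<lambda>p. \<chi> j.
     derivation v (derivation w (coord j)) p - derivation w (derivation v (coord j)) p)"

definition ad :: "vector_field \<Rightarrow> vector_field \<Rightarrow> vector_field" where
  "ad v w = lie_bracket v w"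

definition Delta :: scalar_field where
  "Delta = (\<lambda>p. p $ 1 * p $ 3 - (p $ 2)\<^sup>2)"

definition N :: vector_field where
  "N = (\<lambda>p. vector [0, p $ 1, 2 * p $ 2])"

definition M :: vector_field where
  "M = (\<lambda>p. vector [2 * p $ 2, p $ 3, 0])"

text \<open>Only used for l \<open>\<le>\<close> m, where the subtraction does not truncate.\<close>

definition kappa :: "nat \<Rightarrow> nat \<Rightarrow> real" where
  "kappa l m = fact m / fact (m - l)"

text \<open>The upper index l is an integer with \<open>l \<ge> -1\<close>, so \<open>nat (l + 1)\<close> is \<open>l + 1\<close>.\<close>

definition B :: "nat \<Rightarrow> nat \<Rightarrow> int \<Rightarrow> vector_field" where
  "B i k l = (\<lambda>p.
     (1 / kappa (nat (l + 1)) (2 * i + 2)) *\<^sub>R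
     (ad N ^^ nat (l + 1)) (\<lambda>q. ((q $ 3) ^ i * Delta q ^ k) *\<^sub>R M q) p)"

definition b :: "nat \<Rightarrow> nat \<Rightarrow> int \<Rightarrow> scalar_field" where
  "b i k l = (\<lambda>p.
     - ((derivation N ^^ nat (l + 1)) (\<lambda>q. (q $ 3) ^ (i + 1) * Delta q ^ k) p
        / ((real i + 1) * kappa (nat (l + 1)) (2 * i + 2))))"

definition phi :: "nat \<Rightarrow> nat \<Rightarrow> int \<Rightarrow> vector_field" where
  "phi i k l = (\<lambda>p. - b i k l p *\<^sub>R grad Delta p)"

end

theory Submission
  imports Defs
begin

text \<open>Since \<open>N \<Delta> = 0\<close> and \<open>N\<close> is divergence free, \<open>ad N\<close> maps \<open>\<nabla>f \<times> \<nabla>\<Delta>\<close> to \<open>\<nabla>(N f) \<times> \<nabla>\<Delta>\<close>.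
  As \<open>\<nabla>z \<times> \<nabla>\<Delta> = M\<close>, the field \<open>z\<^sup>i \<Delta>\<^sup>k M\<close> equals \<open>\<nabla>f \<times> \<nabla>\<Delta>\<close> for \<open>f = z\<^sup>i\<^sup>+\<^sup>1 \<Delta>\<^sup>k / (i + 1)\<close>, so
  its iterated brackets with \<open>N\<close> are \<open>\<nabla>(N\<^sup>n f) \<times> \<nabla>\<Delta> = curl (N\<^sup>n f \<nabla>\<Delta>)\<close>.\<close>

section \<open>Rules for partial derivatives\<close>

lemma pderivative_eqI:
  assumes "(f has_derivative f') (at p)"
  shows "pderivative j f p = f' (axis j 1)"
  using frechet_derivative_at[OF assms] by (simp add: pderivative_def)

lemma pderivative_const [simp]: "pderivative j (\<lambda>p. c) = (\<lambda>p. 0)"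
  by (rule ext, subst pderivative_eqI, rule has_derivative_const) simp

lemma pderivative_bounded_linear:
  assumes "bounded_linear f"
  shows "pderivative j f = (\<lambda>p. f (axis j 1))"
  by (rule ext, subst pderivative_eqI, rule bounded_linear_imp_has_derivative[OF assms]) simp

lemma pderivative_component [simp]:
  "pderivative j (\<lambda>p. p $ i) = (\<lambda>p. if i = j then 1 else 0)"
  by (simp add: pderivative_bounded_linear[OF bounded_linear_vec_nth] axis_def)

lemma pderivative_add:
  assumes "f differentiable at p" "g differentiable at p"
  shows "pderivative j (\<lambda>q. f q + g q) p = pderivative j f p + pderivative j g p"
  unfolding pderivative_def
  by (subst frechet_derivative_at[OF has_derivative_add, symmetric])
    (use assms in \<open>auto simp: frechet_derivative_works\<close>)

lemma pderivative_diff: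
  assumes "f differentiable at p" "g differentiable at p"
  shows "pderivative j (\<lambda>q. f q - g q) p = pderivative j f p - pderivative j g p"
  unfolding pderivative_def
  by (subst frechet_derivative_at[OF has_derivative_diff, symmetric])
    (use assms in \<open>auto simp: frechet_derivative_works\<close>)

lemma pderivative_mult:
  assumes "f differentiable at p" "g differentiable at p"
  shows "pderivative j (\<lambda>q. f q * g q) p = f p * pderivative j g p + pderivative j f p * g p"
  unfolding pderivative_def
  by (subst frechet_derivative_at[OF has_derivative_mult, symmetric])
    (use assms in \<open>auto simp: frechet_derivative_works\<close>)

lemma pderivative_minus:
  assumes "f differentiable at p"
  shows "pderivative j (\<lambda>q. - f q) p = - pderivative j f p"
  unfolding pderivative_def
  by (subst frechet_derivative_at[OF has_derivative_minus, symmetric])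
    (use assms in \<open>auto simp: frechet_derivative_works\<close>)

text \<open>The last fact discharges the differentiability side conditions of the others, so
  polynomiality is the only regularity to be tracked.\<close>

lemmas pderivative_rules =
  pderivative_add pderivative_diff pderivative_minus pderivative_mult differentiable_at_real_polynomial_function

section \<open>Polynomial functions and their partial derivatives\<close>

lemma real_polynomial_function_component:
  "real_polynomial_function (\<lambda>p :: real^'n. p $ j)"
  by (rule real_polynomial_function.intros(1)[OF bounded_linear_vec_nth])

lemma real_polynomial_function_pderivative:
  assumes "real_polynomial_function f"
  shows "real_polynomial_function (pderivative j f)"
  using assms
proof (induction rule: real_polynomial_function.induct)
  case (linear f)
  then show ?case by (simp add: pderivative_bounded_linear real_polynomial_function.intros(2))
next
  case (const c)
  then show ?case by (simp add: real_polynomial_function.intros(2))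
next
  case (add f g)
  have "pderivative j (\<lambda>q. f q + g q) = (\<lambda>p. pderivative j f p + pderivative j g p)"
    using add.hyps by (auto simp: pderivative_rules)
  with add.IH show ?case by (simp add: real_polynomial_function.intros(3))
next
  case (mult f g)
  have "pderivative j (\<lambda>q. f q * g q) = (\<lambda>p. f p * pderivative j g p + pderivative j f p * g p)"
    using mult.hyps by (auto simp: pderivative_rules)
  with mult show ?case
    by (simp add: real_polynomial_function.intros(3,4))
qed

lemma real_polynomial_function_Delta: "real_polynomial_function Delta"
  unfolding Delta_def
  by (intro real_polynomial_function_diff real_polynomial_function.intros(4)
      real_polynomial_function_power real_polynomial_function_component)

lemmas real_polynomial_function_rules =
  real_polynomial_function.intros(2-4)
  real_polynomial_function_diff real_polynomial_function_minus real_polynomial_function_power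
  real_polynomial_function_component real_polynomial_function_pderivative
  real_polynomial_function_Delta

text \<open>Induction on the polynomial: linear functions have constant first partials, and
  expanding a product twice gives an expression symmetric in the two directions, up to the induction
  hypotheses.\<close>

lemma pderivative_commute:
  assumes "real_polynomial_function f"
  shows "pderivative i (pderivative j f) p = pderivative j (pderivative i f) p"
  using assms
proof (induction arbitrary: p rule: real_polynomial_function.induct)
  case (linear f)
  then show ?case by (simp add: pderivative_bounded_linear)
next
  case (const c)
  then show ?case by simp
next
  case (add f g)
  have "pderivative j (\<lambda>q. f q + g q) = (\<lambda>p. pderivative j f p + pderivative j g p)" for j
    using add.hyps by (auto simp: pderivative_rules)
  with add show ?case
    by (simp add: pderivative_rules real_polynomial_function_rules)
next
  case (mult f g)
  have "pderivative j (\<lambda>q. f q * g q) = (\<lambda>p. f p * pderivative j g p + pderivative j f p * g p)" for j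
    using mult.hyps by (auto simp: pderivative_rules)
  with mult show ?case
    by (simp add: pderivative_rules real_polynomial_function_rules)
qed

text \<open>The exponent \<open>Suc n\<close> avoids a truncated \<open>n - 1\<close>.\<close>

lemma pderivative_power_Suc:
  assumes "real_polynomial_function f"
  shows "pderivative j (\<lambda>q. f q ^ Suc n) p = (real n + 1) * f p ^ n * pderivative j f p"
proof (induction n)
  case (Suc n)
  have "pderivative j (\<lambda>q. f q * f q ^ Suc n) p =
      f p * pderivative j (\<lambda>q. f q ^ Suc n) p + pderivative j f p * f p ^ Suc n"
    using assms by (intro pderivative_mult differentiable_at_real_polynomial_function
        real_polynomial_function_power)
  with Suc show ?case by (simp add: algebra_simps)
qed simp

section \<open>\<open>Delta\<close> and the action of \<open>N\<close> on scalars\<close>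

lemma pderivative_Delta:
  "pderivative 1 Delta = (\<lambda>p. p $ 3)"
  "pderivative 2 Delta = (\<lambda>p. - 2 * p $ 2)"
  "pderivative 3 Delta = (\<lambda>p. p $ 1)"
  by (auto simp: Delta_def power2_eq_square pderivative_rules real_polynomial_function_rules)

lemma grad_Delta: "grad Delta = (\<lambda>p. vector [p $ 3, - 2 * p $ 2, p $ 1])"
  by (auto simp: grad_def vec_eq_iff forall_3 pderivative_Delta)

lemma derivation_N: "derivation N f = (\<lambda>p. p $ 1 * pderivative 2 f p + 2 * p $ 2 * pderivative 3 f p)"
  by (auto simp: derivation_def sum_3 N_def)

lemma real_polynomial_function_derivation_N:
  assumes "real_polynomial_function f"
  shows "real_polynomial_function (derivation N f)"
  unfolding derivation_N
  by (intro real_polynomial_function_rules assms)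

lemma real_polynomial_function_derivation_N_funpow:
  assumes "real_polynomial_function f"
  shows "real_polynomial_function ((derivation N ^^ n) f)"
  by (induction n) (auto intro: assms real_polynomial_function_derivation_N)

text \<open>Leibniz rule with one vanishing term: kernel elements behave like constants for
  \<open>N\<close>. It serves for genuine constants and for powers of \<open>Delta\<close>.\<close>

lemma derivation_N_mult_kernel:
  assumes "real_polynomial_function f" "real_polynomial_function g" "derivation N g = (\<lambda>p. 0)"
  shows "derivation N (\<lambda>p. g p * f p) = (\<lambda>p. g p * derivation N f p)"
proof
  fix p
  have "derivation N (\<lambda>p. g p * f p) p = g p * derivation N f p + derivation N g p * f p"
    unfolding derivation_N using assms(1,2) by (simp add: pderivative_rules algebra_simps)
  then show "derivation N (\<lambda>p. g p * f p) p = g p * derivation N f p"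
    by (simp add: assms(3))
qed

lemma derivation_N_funpow_mult_kernel:
  assumes "real_polynomial_function f" "real_polynomial_function g" "derivation N g = (\<lambda>p. 0)"
  shows "(derivation N ^^ n) (\<lambda>p. g p * f p) = (\<lambda>p. g p * (derivation N ^^ n) f p)"
  by (induction n)
    (simp_all add: derivation_N_mult_kernel assms real_polynomial_function_derivation_N_funpow)

text \<open>By the chain rule it comes down to \<open>N\<close> applied to \<open>Delta\<close>,
  which is x(-2y) + 2yx = 0.\<close>

lemma derivation_N_Delta_power: "derivation N (\<lambda>p. Delta p ^ k) = (\<lambda>p. 0)"
proof (cases k)
  case 0
  then show ?thesis by (simp add: derivation_N)
next
  case (Suc n)
  then show ?thesis
    by (simp add: derivation_N pderivative_power_Suc real_polynomial_function_Delta
        pderivative_Delta del: power_Suc)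
qed

section \<open>Cross products of gradients with the gradient of \<open>Delta\<close>\<close>

definition grad_cross_grad_Delta :: "scalar_field \<Rightarrow> vector_field" where
  "grad_cross_grad_Delta f = (\<lambda>p. vector
     [p $ 1 * pderivative 2 f p + 2 * p $ 2 * pderivative 3 f p,
      p $ 3 * pderivative 3 f p - p $ 1 * pderivative 1 f p,
      - (2 * p $ 2 * pderivative 1 f p + p $ 3 * pderivative 2 f p)])"

text \<open>The product rule for curl leaves only the cross product, because the gradient of
  \<open>Delta\<close> is itself curl free.\<close>

lemma curl_scale_grad_Delta:
  assumes "real_polynomial_function f"
  shows "curl (\<lambda>p. f p *\<^sub>R grad Delta p) = grad_cross_grad_Delta f"
  using assms
  by (auto simp: curl_def grad_cross_grad_Delta_def grad_Delta fun_eq_iff vec_eq_iff forall_3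
      pderivative_rules real_polynomial_function_rules algebra_simps)

lemma differentiable_on_scale_grad_Delta:
  assumes "real_polynomial_function f"
  shows "(\<lambda>p. f p *\<^sub>R grad Delta p) differentiable_on UNIV"
proof (rule differentiable_on_polynomial_function)
  show "polynomial_function (\<lambda>p. f p *\<^sub>R grad Delta p)"
    using assms
    by (auto simp: polynomial_function_iff_Basis_inner Basis_vec_def inner_axis grad_def
        real_polynomial_function_rules)
qed

text \<open>Checked in components: with the convention vw - wv, entry j of the bracket of
  \<open>N\<close> with w is N(w_j) - w(N_j).\<close>

lemma ad_N_grad_cross_grad_Delta:
  assumes "real_polynomial_function f"
  shows "ad N (grad_cross_grad_Delta f) = grad_cross_grad_Delta (derivation N f)"
proof -
  \<comment> \<open>Oriented as rewrite rules, these bring all mixed second partials into one order,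
    so that the second-order terms on both sides match.\<close>
  have "pderivative 3 (pderivative 2 f) p = pderivative 2 (pderivative 3 f) p"
    "pderivative 3 (pderivative 1 f) p = pderivative 1 (pderivative 3 f) p"
    "pderivative 2 (pderivative 1 f) p = pderivative 1 (pderivative 2 f) p" for p
    by (rule pderivative_commute[OF assms])+
  then show ?thesis
    using assms unfolding ad_def lie_bracket_def derivation_coord
    by (auto simp: derivation_def sum_3 N_def grad_cross_grad_Delta_def fun_eq_iff vec_eq_iff
        forall_3 pderivative_rules real_polynomial_function_rules algebra_simps)
qed

lemma ad_N_funpow_grad_cross_grad_Delta:
  assumes "real_polynomial_function f"
  shows "(ad N ^^ n) (grad_cross_grad_Delta f) = grad_cross_grad_Delta ((derivation N ^^ n) f)"
  by (induction n)
    (simp_all add: ad_N_grad_cross_grad_Delta real_polynomial_function_derivation_N_funpow assms)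

lemma grad_cross_grad_Delta_scale:
  assumes "real_polynomial_function f"
  shows "grad_cross_grad_Delta (\<lambda>p. c * f p) = (\<lambda>p. c *\<^sub>R grad_cross_grad_Delta f p)"
  using assms
  by (auto simp: grad_cross_grad_Delta_def vec_eq_iff forall_3 pderivative_rules
      real_polynomial_function_rules algebra_simps)

text \<open>Differentiating the power of \<open>Delta\<close> contributes a multiple of the gradient
  of \<open>Delta\<close>, which the cross product kills.\<close>

lemma grad_cross_grad_Delta_mult_Delta_power:
  assumes "real_polynomial_function f"
  shows "grad_cross_grad_Delta (\<lambda>p. f p * Delta p ^ k) =
    (\<lambda>p. Delta p ^ k *\<^sub>R grad_cross_grad_Delta f p)"
proof (cases k)
  case (Suc n)
  then show ?thesis
    using assms
    by (auto simp: grad_cross_grad_Delta_def vec_eq_iff forall_3 pderivative_rules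
      real_polynomial_function_rules pderivative_power_Suc pderivative_Delta algebra_simps
      simp del: power_Suc)
qed simp

text \<open>The gradient of z is (0, 0, 1), and its cross product with (z, -2y, x) is (2y, z, 0),
  which is \<open>M\<close>. The factor \<open>real i + 1\<close> comes from differentiating the
  power of z.\<close>

lemma grad_cross_grad_Delta_z_power_Delta_power:
  "grad_cross_grad_Delta (\<lambda>q. (q $ 3) ^ (i + 1) * Delta q ^ k) =
    (\<lambda>q. (real i + 1) *\<^sub>R ((q $ 3) ^ i * Delta q ^ k) *\<^sub>R M q)"
proof -
  have "grad_cross_grad_Delta (\<lambda>q. (q $ 3) ^ Suc i) = (\<lambda>q. ((real i + 1) * (q $ 3) ^ i) *\<^sub>R M q)"
    by (auto simp: grad_cross_grad_Delta_def M_def vec_eq_iff forall_3 pderivative_power_Suc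
        real_polynomial_function_component simp del: power_Suc)
  then show ?thesis
    using grad_cross_grad_Delta_mult_Delta_power[of "\<lambda>q. (q $ 3) ^ Suc i" k]
    by (simp add: real_polynomial_function_rules mult_ac del: power_Suc)
qed

theorem theorem4p8:
  fixes i k :: nat and l :: int
  assumes "-1 \<le> l" and "l \<le> 2 * int i + 1"
  shows "vector_potential (phi i k l) (B i k l) \<and>
    phi i k l = (\<lambda>p.
      (Delta p ^ k * (derivation N ^^ nat (l + 1)) (\<lambda>q. (q $ 3) ^ (i + 1)) p
        / ((real i + 1) * kappa (nat (l + 1)) (2 * i + 2)))
      *\<^sub>R vector [p $ 3, - 2 * p $ 2, p $ 1])"
proof
  define n where "n = nat (l + 1)"
  define \<kappa> where "\<kappa> = kappa n (2 * i + 2)"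
  define g where "g = (\<lambda>q :: real^3. (q $ 3) ^ (i + 1) * Delta q ^ k)"
  \<comment> \<open>This is \<open>- b i k l\<close>, with the constant written as a left factor to
    fit the scaling lemma.\<close>
  define f where "f = (\<lambda>p. 1 / ((real i + 1) * \<kappa>) * (derivation N ^^ n) g p)"
  have g: "real_polynomial_function g"
    unfolding g_def by (intro real_polynomial_function_rules)
  have f: "real_polynomial_function f"
    unfolding f_def
    by (intro real_polynomial_function_rules real_polynomial_function_derivation_N_funpow g)
  have phi: "phi i k l = (\<lambda>p. f p *\<^sub>R grad Delta p)"
    by (simp add: phi_def b_def f_def g_def n_def \<kappa>_def)
  \<comment> \<open>The seed of the iterated brackets is put in cross product form; dividing by
    \<open>real i + 1\<close> cancels the factor from the power of z.\<close>
  have "(\<lambda>q. ((q $ 3) ^ i * Delta q ^ k) *\<^sub>R M q) =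
      grad_cross_grad_Delta (\<lambda>q. 1 / (real i + 1) * g q)"
    unfolding grad_cross_grad_Delta_scale[OF g]
    unfolding g_def grad_cross_grad_Delta_z_power_Delta_power
    by (simp add: add_nonneg_eq_0_iff)
  then have "B i k l =
      (\<lambda>p. (1 / \<kappa>) *\<^sub>R (ad N ^^ n) (grad_cross_grad_Delta (\<lambda>q. 1 / (real i + 1) * g q)) p)"
    by (simp add: B_def n_def \<kappa>_def)
  also have "\<dots> = (\<lambda>p. (1 / \<kappa>) *\<^sub>R
      grad_cross_grad_Delta (\<lambda>q. 1 / (real i + 1) * (derivation N ^^ n) g q) p)"
    \<comment> \<open>A constant lies in the kernel of \<open>N\<close>, so it passes through all
      \<open>n\<close> applications.\<close>
    using derivation_N_funpow_mult_kernel[OF g, of "\<lambda>p. 1 / (real i + 1)" n]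
      ad_N_funpow_grad_cross_grad_Delta[of "\<lambda>q. 1 / (real i + 1) * g q" n]
    by (simp add: g real_polynomial_function_divide real_polynomial_function_rules derivation_N)
  also have "\<dots> = grad_cross_grad_Delta f"
    unfolding f_def
    by (simp only: grad_cross_grad_Delta_scale real_polynomial_function_derivation_N_funpow[OF g])
       (simp add: mult.commute)
  finally show "vector_potential (phi i k l) (B i k l)"
    unfolding vector_potential_def phi
    by (simp add: curl_scale_grad_Delta differentiable_on_scale_grad_Delta f)
  \<comment> \<open>For the explicit formula, the power of \<open>Delta\<close> is a kernel element
    and leaves the iterated derivative; commuting it to the front matches the kernel lemma.\<close>
  have "(derivation N ^^ n) g = (\<lambda>p. Delta p ^ k * (derivation N ^^ n) (\<lambda>q. (q $ 3) ^ (i + 1)) p)"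
    unfolding g_def mult.commute[of _ "Delta _ ^ k"]
    by (intro derivation_N_funpow_mult_kernel real_polynomial_function_rules
        derivation_N_Delta_power)
  then show "phi i k l = (\<lambda>p.
      (Delta p ^ k * (derivation N ^^ nat (l + 1)) (\<lambda>q. (q $ 3) ^ (i + 1)) p
        / ((real i + 1) * kappa (nat (l + 1)) (2 * i + 2)))
      *\<^sub>R vector [p $ 3, - 2 * p $ 2, p $ 1])"
    by (simp add: phi f_def grad_Delta n_def \<kappa>_def)
qed

end
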